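(* Let $0<q<1$. The equation $$\prod_{v_k\sim v}\frac{\operatorname{sn}\big(\frac{\beta_v-\beta_{v_k}+iK'}{2};q\big)}{\operatorname{sn}\big(\frac{\beta_v+\beta_{v_k}+iK'}{2};q\big)}=1$$ describing the radii of spherical orthogonal ring patterns, as well as the equation $$\prod_{v_k\sim v}\frac{\operatorname{sn}\big(\frac{\gamma_v-\gamma_{v_k}+iK'}{2};q\big)}{\operatorname{sn}\big(\frac{\gamma_v+\gamma_{v_k}-iK'}{2};q\big)}=1$$ describing the radii of hyperbolic orthogonal ring patterns (products over the four neighbors $v_k$ of $v$), is a special case of the Laplace equation $$F(X,X_1,a-b)\,F(X,X_2,b-a)\,F(X,X_3,a-b)\,F(X,X_4,b-a)=1$$ for the Q4 discrete integrable equation on the square grid, namely the one with parameter $a-b$ on the edge equal to $iK'$. The identification is by the change of variables $X_v=\beta_v+\varepsilon_v iK'$ in the spherical case, and additionally $\beta_v=\gamma_v+iK'$ in the hyperbolic case, where $\varepsilon_v=+1$ and $\varepsilon_v=-1$ alternately on the consecutive parallel lines (of the grid of the Laplace system) that contain $X,X_2,X_4$.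
   Context: Grid: the even sublattice $G=\{(m,n)\in\mathbb{Z}^2:m+n\text{ even}\}$ is itself a square grid; the four neighbors of $v=(m,n)\in G$ are $(m+1,n+1),(m-1,n+1),(m-1,n-1),(m+1,n-1)$, and the variables there are denoted $X_1,X_2,X_3,X_4$ respectively, with $X$ the variable at $v$. The lines containing $X,X_2,X_4$ are $m+n=\mathrm{const}$. Elliptic notation: $\operatorname{sn}(\cdot;q)$ is the Jacobi function of modulus $q$, $K=K(q)$, $K'=K'(q)$ are its complete elliptic integrals, $\tau=iK'/K$, and $\Theta_j(X|\tau)=\theta_j\big(\frac{X}{2K}\big|\tau\big)$, $j=1,\dots,4$, are Jacobi theta functions. Let $\tilde\tau=2\tau$, let $k$ be the modulus whose elliptic curve has period $\tilde\tau$, i.e. $iK'(k)/K(k)=\tilde\tau$ (so, up to scaling, the torus of modulus $k$ is the double cover with periods $4K,4i\tilde K'$, $\tilde K'=2K'$, of the torus with periods $4K,4iK'$ of modulus $q$), and let $\lambda=K(k)/K$. Q4 equation: for fields $x_1,x_2,x_3,x_4$ at the consecutive vertices of an elementary square and parameters $\alpha$ on the edges $x_1x_2$, $x_3x_4$ and $\beta$ on the edges $x_2x_3$, $x_4x_1$, $$\operatorname{sn}(\alpha;k)(x_1x_2+x_3x_4)-\operatorname{sn}(\beta;k)(x_1x_4+x_2x_3)-\operatorname{sn}(\alpha-\beta;k)(x_1x_3+x_2x_4)+\operatorname{sn}(\alpha-\beta;k)\operatorname{sn}(\alpha;k)\operatorname{sn}(\beta;k)(1+k^2x_1x_2x_3x_4)=0.$$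 With $\alpha=\lambda a$, $\beta=\lambda b$ and $x_i=\operatorname{sn}(\lambda(X_i+K);k)$ the Q4 equation has the three-leg form $$\frac{F(X_1,X_2,a)}{F(X_1,X_4,b)}=F(X_1,X_3,a-b),$$ where $$F(X,Y,a)=\frac{\Theta_1(\frac12(X+Y+a)|\tau)\,\Theta_1(\frac12(X-Y+a)|\tau)}{\Theta_1(\frac12(X+Y-a)|\tau)\,\Theta_1(\frac12(X-Y-a)|\tau)}.$$ (Without the shift by $K$, the function $F$ is $\frac{\Theta_2\Theta_3(\frac12(X+Y+a)|\tilde\tau)\;\Theta_1\Theta_4(\frac12(X-Y+a)|\tilde\tau)}{\Theta_2\Theta_3(\frac12(X+Y-a)|\tilde\tau)\;\Theta_1\Theta_4(\frac12(X-Y-a)|\tilde\tau)}$, with $\Theta_j(X|\tilde\tau)=\theta_j(\frac{X}{2K}|\tilde\tau)$.) Laplace equation: imposing Q4 on the four squares of $\mathbb{Z}^2$ around a vertex (parameter $a$ on horizontal and $b$ on vertical edges) with central variable $X$, diagonal neighbors $X_1,\dots,X_4$ and direct neighbors $Y_1,\dots,Y_4$, and multiplying the four three-leg forms based at $X$, eliminates the $Y_i$ and gives the Laplace equation in the claim. *)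

theory Defs
  imports "HOL-Analysis.Analysis"
begin

section \<open>Theta functions and the Jacobi function sn\<close>

text \<open>
  Theta functions in the normalisation with quasi-periods \<open>1\<close> and \<open>\<tau>\<close>, so that
  \<open>\<theta>\<^sub>1(z + 1) = - \<theta>\<^sub>1(z)\<close>; the nome is \<open>exp (\<i> \<pi> \<tau>)\<close> with \<open>Im \<tau> > 0\<close>. The bilateral series
  for \<open>\<theta>\<^sub>1\<close> is the usual
  \<open>2 \<Sum>\<^sub>n\<^sub>\<ge>\<^sub>0 (-1)\<^sup>n exp (\<i> \<pi> \<tau> (n + 1/2)\<^sup>2) sin ((2 n + 1) \<pi> z)\<close>.
\<close>

definition theta1 :: "complex \<Rightarrow> complex \<Rightarrow> complex" where
  "theta1 z \<tau> = - \<i> * (\<Sum>\<^sub>\<infinity>n\<in>(UNIV::int set). (-1) powi n *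
     exp (\<i> * of_real pi * \<tau> * (of_int n + 1/2)\<^sup>2 + \<i> * of_real pi * (2 * of_int n + 1) * z))"

definition theta2 :: "complex \<Rightarrow> complex \<Rightarrow> complex" where
  "theta2 z \<tau> = (\<Sum>\<^sub>\<infinity>n\<in>(UNIV::int set).
     exp (\<i> * of_real pi * \<tau> * (of_int n + 1/2)\<^sup>2 + \<i> * of_real pi * (2 * of_int n + 1) * z))"

definition theta3 :: "complex \<Rightarrow> complex \<Rightarrow> complex" where
  "theta3 z \<tau> = (\<Sum>\<^sub>\<infinity>n\<in>(UNIV::int set).
     exp (\<i> * of_real pi * \<tau> * (of_int n)\<^sup>2 + \<i> * of_real pi * (2 * of_int n) * z))"

definition theta4 :: "complex \<Rightarrow> complex \<Rightarrow> complex" where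
  "theta4 z \<tau> = (\<Sum>\<^sub>\<infinity>n\<in>(UNIV::int set). (-1) powi n *
     exp (\<i> * of_real pi * \<tau> * (of_int n)\<^sup>2 + \<i> * of_real pi * (2 * of_int n) * z))"

text \<open>Complete elliptic integrals as functions of the modulus (not of its square).\<close>

definition ellK :: "real \<Rightarrow> real" where
  "ellK q = integral {0..pi/2} (\<lambda>\<phi>. 1 / sqrt (1 - q\<^sup>2 * (sin \<phi>)\<^sup>2))"

definition ellK' :: "real \<Rightarrow> real" where
  "ellK' q = ellK (sqrt (1 - q\<^sup>2))"

definition tau :: "real \<Rightarrow> complex" where
  "tau q = \<i> * of_real (ellK' q) / of_real (ellK q)"

text \<open>The half-period \<open>\<i> K'\<close>.\<close>

definition iK' :: "real \<Rightarrow> complex" where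
  "iK' q = \<i> * of_real (ellK' q)"

text \<open>
  The meromorphic function sn on the complex plane, of modulus \<open>q\<close>, by its standard definition as
  a theta quotient (DLMF 22.2.4, Whittaker and Watson 22.1). At a pole the value is \<open>0\<close>.
\<close>

definition jacobi_sn :: "complex \<Rightarrow> real \<Rightarrow> complex" where
  "jacobi_sn u q =
     theta3 0 (tau q) / theta2 0 (tau q) *
     (theta1 (u / (2 * of_real (ellK q))) (tau q) / theta4 (u / (2 * of_real (ellK q))) (tau q))"

definition Theta1 :: "real \<Rightarrow> complex \<Rightarrow> complex" where
  "Theta1 q X = theta1 (X / (2 * of_real (ellK q))) (tau q)"


section \<open>The grid\<close>

text \<open>
  The even sublattice, with the neighbours in the order of the variables
  \<open>X\<^sub>1, X\<^sub>2, X\<^sub>3, X\<^sub>4\<close>.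
\<close>

type_synonym vertex = "int \<times> int"

definition grid :: "vertex set" where
  "grid = {(m, n). even (m + n)}"

fun nb1 :: "vertex \<Rightarrow> vertex" where "nb1 (m, n) = (m + 1, n + 1)"
fun nb2 :: "vertex \<Rightarrow> vertex" where "nb2 (m, n) = (m - 1, n + 1)"
fun nb3 :: "vertex \<Rightarrow> vertex" where "nb3 (m, n) = (m - 1, n - 1)"
fun nb4 :: "vertex \<Rightarrow> vertex" where "nb4 (m, n) = (m + 1, n - 1)"

definition neighbours :: "vertex \<Rightarrow> vertex set" where
  "neighbours v = {nb1 v, nb2 v, nb3 v, nb4 v}"

text \<open>
  The lines of the grid containing \<open>X, X\<^sub>2, X\<^sub>4\<close> are \<open>m + n = c\<close> with \<open>c\<close> even;
  consecutive ones differ by \<open>2\<close> in \<open>c\<close>. There are exactly two such sign functions on the grid.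
\<close>

definition alternating_signs :: "(vertex \<Rightarrow> int) \<Rightarrow> bool" where
  "alternating_signs \<epsilon> \<longleftrightarrow>
     (\<forall>v\<in>grid. \<epsilon> v = 1 \<or> \<epsilon> v = -1) \<and>
     (\<forall>v\<in>grid. \<forall>w\<in>grid. fst w + snd w = fst v + snd v \<longrightarrow> \<epsilon> w = \<epsilon> v) \<and>
     (\<forall>v\<in>grid. \<forall>w\<in>grid. fst w + snd w = fst v + snd v + 2 \<longrightarrow> \<epsilon> w = - \<epsilon> v)"


section \<open>The equations\<close>

text \<open>
  In all equations below a vanishing denominator makes the corresponding product \<open>0\<close> (division by
  zero being \<open>0\<close>), hence the equation false. So each of them asserts in particular that all theta
  functions occurring in it, including those in the numerators and denominators of sn, are
  nonzero. For real fields \<open>\<beta>\<close>, \<open>\<gamma>\<close> no such degeneration occurs in the ring pattern equations.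
\<close>

definition F :: "real \<Rightarrow> complex \<Rightarrow> complex \<Rightarrow> complex \<Rightarrow> complex" where
  "F q X Y a =
     (Theta1 q ((X + Y + a) / 2) * Theta1 q ((X - Y + a) / 2)) /
     (Theta1 q ((X + Y - a) / 2) * Theta1 q ((X - Y - a) / 2))"

text \<open>
  The three-leg form of Q4 on a square with consecutive fields \<open>X\<^sub>1, X\<^sub>2, X\<^sub>3, X\<^sub>4\<close>, based
  at \<open>X\<^sub>1\<close>, with parameter \<open>a\<close> on the edge to \<open>X\<^sub>2\<close> and \<open>b\<close> on the edge to \<open>X\<^sub>4\<close>. The Q4
  fields are \<open>x\<^sub>i = sn (\<lambda> (X\<^sub>i + K); k)\<close>, where \<open>\<i> K'(k) / K(k) = 2 \<tau>\<close> and
  \<open>\<lambda> = K(k) / K(q)\<close>.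
\<close>

definition three_leg_Q4 ::
  "real \<Rightarrow> complex \<Rightarrow> complex \<Rightarrow> complex \<Rightarrow> complex \<Rightarrow> complex \<Rightarrow> complex \<Rightarrow> bool" where
  "three_leg_Q4 q a b X\<^sub>1 X\<^sub>2 X\<^sub>3 X\<^sub>4 \<longleftrightarrow> F q X\<^sub>1 X\<^sub>2 a / F q X\<^sub>1 X\<^sub>4 b = F q X\<^sub>1 X\<^sub>3 (a - b)"

text \<open>
  The Laplace equation for Q4 at the vertex \<open>v\<close>, with parameter \<open>a\<close> on the horizontal and \<open>b\<close> on the
  vertical edges of the square lattice.
\<close>

definition laplace_Q4 ::
  "real \<Rightarrow> complex \<Rightarrow> complex \<Rightarrow> (vertex \<Rightarrow> complex) \<Rightarrow> vertex \<Rightarrow> bool" where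
  "laplace_Q4 q a b X v \<longleftrightarrow>
     F q (X v) (X (nb1 v)) (a - b) * F q (X v) (X (nb2 v)) (b - a) *
     F q (X v) (X (nb3 v)) (a - b) * F q (X v) (X (nb4 v)) (b - a) = 1"

text \<open>
  How it arises: \<open>Y\<^sub>1, \<dots>, Y\<^sub>4\<close> are the fields at the right, upper, left and lower neighbours
  of \<open>v\<close> in the square lattice.
\<close>

lemma three_leg_imp_laplace_Q4:
  assumes "three_leg_Q4 q a b (X v) Y\<^sub>1 (X (nb1 v)) Y\<^sub>2"
    and "three_leg_Q4 q b a (X v) Y\<^sub>2 (X (nb2 v)) Y\<^sub>3"
    and "three_leg_Q4 q a b (X v) Y\<^sub>3 (X (nb3 v)) Y\<^sub>4"
    and "three_leg_Q4 q b a (X v) Y\<^sub>4 (X (nb4 v)) Y\<^sub>1"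
    and "F q (X v) Y\<^sub>1 a \<noteq> 0" "F q (X v) Y\<^sub>2 b \<noteq> 0" "F q (X v) Y\<^sub>3 a \<noteq> 0" "F q (X v) Y\<^sub>4 b \<noteq> 0"
  shows "laplace_Q4 q a b X v"
  using assms(5-8)
  unfolding laplace_Q4_def
    assms(1)[unfolded three_leg_Q4_def, symmetric] assms(2)[unfolded three_leg_Q4_def, symmetric]
    assms(3)[unfolded three_leg_Q4_def, symmetric] assms(4)[unfolded three_leg_Q4_def, symmetric]
  by (simp add: field_simps)

definition spherical_ring_eq :: "real \<Rightarrow> (vertex \<Rightarrow> complex) \<Rightarrow> vertex \<Rightarrow> bool" where
  "spherical_ring_eq q \<beta> v \<longleftrightarrow>
     (\<Prod>w\<in>neighbours v. jacobi_sn ((\<beta> v - \<beta> w + iK' q) / 2) q /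
                        jacobi_sn ((\<beta> v + \<beta> w + iK' q) / 2) q) = 1"

definition hyperbolic_ring_eq :: "real \<Rightarrow> (vertex \<Rightarrow> complex) \<Rightarrow> vertex \<Rightarrow> bool" where
  "hyperbolic_ring_eq q \<gamma> v \<longleftrightarrow>
     (\<Prod>w\<in>neighbours v. jacobi_sn ((\<gamma> v - \<gamma> w + iK' q) / 2) q /
                        jacobi_sn ((\<gamma> v + \<gamma> w - iK' q) / 2) q) = 1"

end

theory Submission
  imports Defs
begin

text \<open>
  Both sides of the claimed equivalences are products over the four neighbours, and they agree
  neighbour by neighbour, up to inversion and up to a multiplier that depends on the central vertex
  only and cancels in the product.

  Write \<open>h = iK'\<close> and \<open>T z = \<Theta>\<^sub>1 ((z + h)/2) / \<Theta>\<^sub>1 ((z - h)/2)\<close> (\<open>shift_quotient\<close>). Since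
  \<open>\<theta>\<^sub>4\<close> is \<open>\<theta>\<^sub>1\<close> shifted by \<open>\<tau>/2\<close>, up to an exponential, \<open>sn ((z + h)/2)\<close> is a constant times
  \<open>exp (i \<pi> (z + h)/(4K)) T z\<close>, so the factor of the neighbour \<open>w\<close> in the spherical equation is
  \<open>r\<^sub>w = exp (- i \<pi> \<beta>\<^sub>w/(2K)) T (\<beta>\<^sub>v - \<beta>\<^sub>w) / T (\<beta>\<^sub>v + \<beta>\<^sub>w)\<close>.

  On the other side \<open>F X Y h = T (X + Y) T (X - Y)\<close>, and \<open>F\<close> with parameter \<open>-h\<close> is the
  reciprocal. With \<open>X = \<beta> + \<epsilon> h\<close>, one of the two arguments \<open>X \<plusminus> Y\<close> is \<open>\<beta>\<^sub>v \<plusminus> \<beta>\<^sub>w\<close>, while the other is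
  shifted by \<open>2 \<epsilon> h\<close>: it is \<open>X - Y\<close> for the neighbours 1 and 3, where the sign changes, and
  \<open>X + Y\<close> for the neighbours 2 and 4, where it does not. The quasi-periodicity of \<open>\<theta>\<^sub>1\<close> turns
  \<open>T\<close> at the shifted argument into an exponential times \<open>1/T\<close>
  (\<open>shift_quotient_add_sign\<close>), and the outcome is
  \<open>F X\<^sub>v X\<^sub>w h = - exp (- i \<pi> X\<^sub>v/(2K)) / r\<^sub>w\<close> in the first case (\<open>F_across_lines\<close>) and
  \<open>F X\<^sub>v X\<^sub>w (-h) = - exp (i \<pi> X\<^sub>v/(2K)) / r\<^sub>w\<close> in the second (\<open>F_along_line\<close>). Each case
  occurs for two of the four neighbours, so the exponentials cancel, and the Laplace product is
  the reciprocal of the spherical one.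

  The hyperbolic equation is the spherical one after \<open>\<beta> = \<gamma> + h\<close>, because sn has the period
  \<open>2h\<close>. The constant in the formula for sn contains \<open>\<theta>\<^sub>3(0)/\<theta>\<^sub>2(0)\<close>, which has to be nonzero to
  cancel; both theta constants are sums of positive numbers.
\<close>

section \<open>Quasi-periodicity of the theta functions\<close>

lemma theta1_add_tau:
  "theta1 (z + \<tau>) \<tau> = - exp (- (\<i> * of_real pi * (\<tau> + 2 * z))) * theta1 z \<tau>"
proof -
  define g where "g = (\<lambda>n::int. (-1::complex) powi n *
     exp (\<i> * of_real pi * \<tau> * (of_int n + 1/2)\<^sup>2 + \<i> * of_real pi * (2 * of_int n + 1) * z))"
  define h where "h = (\<lambda>n::int. (-1::complex) powi n *
     exp (\<i> * of_real pi * \<tau> * (of_int n + 1/2)\<^sup>2 +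
       \<i> * of_real pi * (2 * of_int n + 1) * (z + \<tau>)))"
  have h_eq: "h n = - exp (- (\<i> * of_real pi * (\<tau> + 2 * z))) * g (n + 1)" for n
  proof -
    have "exp (\<i> * of_real pi * \<tau> * (of_int n + 1/2)\<^sup>2 +
        \<i> * of_real pi * (2 * of_int n + 1) * (z + \<tau>))
      = exp (- (\<i> * of_real pi * (\<tau> + 2 * z))) *
        exp (\<i> * of_real pi * \<tau> * (of_int (n + 1) + 1/2)\<^sup>2 +
          \<i> * of_real pi * (2 * of_int (n + 1) + 1) * z)"
      unfolding exp_add [symmetric]
      by (rule arg_cong [where f = exp]) (simp add: field_simps power2_eq_square)
    moreover have "(-1::complex) powi (n + 1) = - ((-1) powi n)"
      by (simp add: power_int_add)
    ultimately show ?thesis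
      by (simp add: g_def h_def)
  qed
  \<comment> \<open>Completing the square absorbs the shift by \<open>\<tau>\<close> into the summation index.\<close>
  have "infsum h UNIV = - exp (- (\<i> * of_real pi * (\<tau> + 2 * z))) * (\<Sum>\<^sub>\<infinity>n. g (n + 1))"
    unfolding h_eq [abs_def] by (rule infsum_cmult_right')
  also have "(\<Sum>\<^sub>\<infinity>n. g (n + 1)) = infsum g UNIV"
    by (rule infsum_reindex_bij_betw) (auto intro!: bij_betwI [of _ _ _ "\<lambda>n. n - 1"])
  finally show ?thesis
    by (simp add: theta1_def g_def h_def)
qed

lemma theta1_diff_half_tau:
  "theta1 (z - \<tau> / 2) \<tau> = - \<i> * exp (\<i> * of_real pi * (z - \<tau> / 4)) * theta4 z \<tau>"
proof -
  have "exp (\<i> * of_real pi * \<tau> * (of_int n + 1/2)\<^sup>2 +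
        \<i> * of_real pi * (2 * of_int n + 1) * (z - \<tau> / 2))
      = exp (\<i> * of_real pi * (z - \<tau> / 4)) *
        exp (\<i> * of_real pi * \<tau> * (of_int n)\<^sup>2 + \<i> * of_real pi * (2 * of_int n) * z)" for n
    unfolding exp_add [symmetric]
    by (rule arg_cong [where f = exp]) (simp add: field_simps power2_eq_square)
  then show ?thesis
    by (simp add: theta1_def theta4_def mult.assoc mult.left_commute [of "_ powi _"]
        infsum_cmult_right')
qed


section \<open>Positivity of the periods and of the theta constants\<close>

text \<open>The integrand is continuous and at least \<open>1\<close>.\<close>

lemma ellK_pos:
  assumes "0 \<le> q" "q < 1"
  shows "0 < ellK q"
proof -
  have pos: "0 < 1 - q\<^sup>2 * (sin x)\<^sup>2" for x
  proof -
    have "q\<^sup>2 * (sin x)\<^sup>2 \<le> q\<^sup>2 * 1"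
      by (intro mult_left_mono) (auto simp: abs_square_le_1)
    also have "\<dots> < 1"
      using assms by (simp add: abs_square_less_1)
    finally show ?thesis by simp
  qed
  have "integral {0..pi/2} (\<lambda>_. 1::real) \<le> ellK q"
    unfolding ellK_def
  proof (rule integral_le)
    show "(\<lambda>\<phi>. 1 / sqrt (1 - q\<^sup>2 * (sin \<phi>)\<^sup>2)) integrable_on {0..pi/2}"
      using pos by (intro integrable_continuous_real continuous_intros)
        (simp add: less_imp_neq [THEN not_sym])
    show "1 \<le> 1 / sqrt (1 - q\<^sup>2 * (sin x)\<^sup>2)" for x
      using pos [of x] by (simp add: field_simps)
  qed auto
  then have "pi / 2 \<le> ellK q"
    by simp
  with pi_gt_zero show ?thesis
    by linarith
qed

lemma ellK'_pos:
  assumes "0 < q" "q < 1"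
  shows "0 < ellK' q"
  unfolding ellK'_def using assms by (intro ellK_pos) (auto simp: power_le_one)

lemma summable_on_power_abs_int:
  fixes r :: real
  assumes "0 \<le> r" "r < 1"
  shows "(\<lambda>n::int. r ^ nat \<bar>n\<bar>) summable_on UNIV"
proof -
  have geom: "(\<lambda>n::nat. r ^ n) summable_on UNIV"
    using assms by (intro norm_summable_imp_summable_on) (simp add: summable_geometric)
  have "(\<lambda>n::int. r ^ nat \<bar>n\<bar>) summable_on range int"
    using geom by (subst summable_on_reindex) (auto simp: o_def)
  moreover have "(\<lambda>n::int. r ^ nat \<bar>n\<bar>) summable_on range (\<lambda>n. - int n)"
    using geom by (subst summable_on_reindex) (auto simp: o_def inj_on_def)
  ultimately have "(\<lambda>n::int. r ^ nat \<bar>n\<bar>) summable_on (range int \<union> range (\<lambda>n. - int n))"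
    by (rule summable_on_union)
  moreover have "range int \<union> range (\<lambda>n. - int n) = UNIV"
  proof -
    have "n \<in> range int \<union> range (\<lambda>n. - int n)" for n
      by (cases n rule: int_cases2) auto
    then show ?thesis by blast
  qed
  ultimately show ?thesis by simp
qed

text \<open>
  At argument \<open>0\<close> and for \<open>\<tau>\<close> on the imaginary axis, the theta series have positive real terms;
  the linear lower bound on the exponents, which the quadratic ones of \<open>\<theta>\<^sub>2\<close> and \<open>\<theta>\<^sub>3\<close>
  satisfy, gives convergence by comparison with a geometric series, so the positive sum is not
  replaced by the default value \<open>0\<close>.
\<close>

lemma infsum_exp_neg_nonzero:
  fixes p :: "int \<Rightarrow> real"
  assumes "0 < c" and bound: "\<And>n. real_of_int \<bar>n\<bar> - 1 \<le> p n"
  shows "(\<Sum>\<^sub>\<infinity>n. exp (of_real (- c * p n))) \<noteq> (0::complex)"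
proof -
  have "(\<lambda>n::int. exp c * exp (- c) ^ nat \<bar>n\<bar>) summable_on UNIV"
    using assms by (intro summable_on_cmult_right summable_on_power_abs_int) auto
  then have summable: "(\<lambda>n. exp (- c * p n)) summable_on UNIV"
  proof (rule summable_on_comparison_test)
    show "exp (- c * p n) \<le> exp c * exp (- c) ^ nat \<bar>n\<bar>" for n
    proof -
      have "c * (real_of_int \<bar>n\<bar> - 1) \<le> c * p n"
        using assms by (intro mult_left_mono) auto
      then show ?thesis
        by (simp add: exp_of_nat_mult [symmetric] exp_add [symmetric] algebra_simps)
    qed
  qed auto
  have "0 < (\<Sum>n\<in>{0::int}. exp (- c * p n))"
    by simp
  also have "\<dots> \<le> (\<Sum>\<^sub>\<infinity>n. exp (- c * p n))"
    using summable by (rule finite_sum_le_infsum) auto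
  finally have "complex_of_real (\<Sum>\<^sub>\<infinity>n. exp (- c * p n)) \<noteq> 0"
    by simp
  also have "complex_of_real (\<Sum>\<^sub>\<infinity>n. exp (- c * p n)) = (\<Sum>\<^sub>\<infinity>n. exp (of_real (- c * p n)))"
    using has_sum_of_real [OF has_sum_infsum [OF summable], where 'a = complex]
    unfolding exp_of_real [symmetric] by (rule infsumI [symmetric])
  finally show ?thesis .
qed

lemma theta_constants_nonzero:
  assumes "0 < t"
  shows "theta2 0 (\<i> * of_real t) \<noteq> 0" and "theta3 0 (\<i> * of_real t) \<noteq> 0"
proof -
  have "real_of_int \<bar>n\<bar> - 1 \<le> (real_of_int n + 1/2)\<^sup>2" for n
  proof -
    have "0 \<le> (real_of_int \<bar>n\<bar> - 1)\<^sup>2" by simp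
    then show ?thesis
      by (auto simp: power2_eq_square abs_if algebra_simps)
  qed
  then have "(\<Sum>\<^sub>\<infinity>n. exp (of_real (- (pi * t) * (real_of_int n + 1/2)\<^sup>2))) \<noteq> (0::complex)"
    using assms by (intro infsum_exp_neg_nonzero) auto
  then show "theta2 0 (\<i> * of_real t) \<noteq> 0"
    by (simp add: theta2_def algebra_simps)
  have "real_of_int \<bar>n\<bar> - 1 \<le> (real_of_int n)\<^sup>2" for n
  proof -
    have "0 \<le> (2 * real_of_int \<bar>n\<bar> - 1)\<^sup>2" by simp
    then show ?thesis
      by (auto simp: power2_eq_square abs_if algebra_simps)
  qed
  then have "(\<Sum>\<^sub>\<infinity>n. exp (of_real (- (pi * t) * (real_of_int n)\<^sup>2))) \<noteq> (0::complex)"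
    using assms by (intro infsum_exp_neg_nonzero) auto
  then show "theta3 0 (\<i> * of_real t) \<noteq> 0"
    by (simp add: theta3_def algebra_simps)
qed


section \<open>The function sn as a quotient of shifted theta functions\<close>

text \<open>
  All exponential multipliers are values of this character, in the scaling of the
  argument that belongs to \<open>\<Theta>\<^sub>1\<close>; its additivity replaces calculations with exponents.
\<close>

definition wave :: "real \<Rightarrow> complex \<Rightarrow> complex" where
  "wave q u = exp (\<i> * of_real pi * u / (2 * of_real (ellK q)))"

lemma wave_nonzero [simp]: "wave q u \<noteq> 0"
  by (simp add: wave_def)

lemma wave_add: "wave q (u + w) = wave q u * wave q w"
  by (simp add: wave_def exp_add [symmetric] ring_distribs add_divide_distrib)

lemma wave_minus: "wave q (- u) = 1 / wave q u"
  by (simp add: wave_def exp_minus field_simps)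

lemma wave_diff: "wave q (u - w) = wave q u / wave q w"
  using wave_add [of q u "- w"] by (simp add: wave_minus)

lemma Theta1_add_2iK':
  assumes "ellK q \<noteq> 0"
  shows "Theta1 q (u + 2 * iK' q) = - Theta1 q u / wave q (2 * u + 2 * iK' q)"
proof -
  have "(u + 2 * iK' q) / (2 * of_real (ellK q)) = u / (2 * of_real (ellK q)) + tau q"
    using assms by (simp add: iK'_def tau_def field_simps)
  moreover have "exp (- (\<i> * of_real pi * (tau q + 2 * (u / (2 * of_real (ellK q)))))) =
      1 / wave q (2 * u + 2 * iK' q)"
    unfolding wave_minus [symmetric] unfolding wave_def
    using assms by (intro arg_cong [where f = exp]) (simp add: iK'_def tau_def field_simps)
  ultimately show ?thesis
    by (simp add: Theta1_def theta1_add_tau)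
qed

text \<open>
  The half-period \<open>iK'\<close> corresponds to \<open>\<tau>/2\<close>, which interchanges \<open>\<theta>\<^sub>1\<close> and \<open>\<theta>\<^sub>4\<close>. This
  removes \<open>\<theta>\<^sub>4\<close> and brings sn into the shape of the factors of \<open>F\<close>.
\<close>

lemma jacobi_sn_eq_Theta1_quotient:
  assumes "0 < q" "q < 1"
  obtains C where "C \<noteq> 0" "\<And>u. jacobi_sn u q = C * wave q u * Theta1 q u / Theta1 q (u - iK' q)"
proof
  have K: "ellK q > 0" "ellK' q > 0"
    using assms by (auto intro: ellK_pos ellK'_pos)
  then have "tau q = \<i> * of_real (ellK' q / ellK q)" and "0 < ellK' q / ellK q"
    by (simp_all add: tau_def)
  then have nz: "theta2 0 (tau q) \<noteq> 0" "theta3 0 (tau q) \<noteq> 0"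
    by (simp_all only: theta_constants_nonzero not_False_eq_True)
  define C where
    "C = - \<i> * exp (- (\<i> * of_real pi * tau q / 4)) * theta3 0 (tau q) / theta2 0 (tau q)"
  show "C \<noteq> 0"
    using nz by (simp add: C_def)
  fix u
  have "(u - iK' q) / (2 * of_real (ellK q)) = u / (2 * of_real (ellK q)) - tau q / 2"
    using K by (simp add: iK'_def tau_def field_simps)
  then have "Theta1 q (u - iK' q) = - \<i> * (wave q u * exp (- (\<i> * of_real pi * tau q / 4))) *
      theta4 (u / (2 * of_real (ellK q))) (tau q)"
    unfolding Theta1_def wave_def exp_add [symmetric]
    by (simp only: theta1_diff_half_tau) (simp add: algebra_simps)
  then show "jacobi_sn u q = C * wave q u * Theta1 q u / Theta1 q (u - iK' q)"
    by (simp add: jacobi_sn_def C_def Theta1_def)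
qed

text \<open>
  The multipliers of \<open>\<Theta>\<^sub>1 u\<close> and \<open>\<Theta>\<^sub>1 (u - iK')\<close> differ by the factor \<open>wave q (2 iK')\<close>,
  which is what the prefactor \<open>wave q u\<close> compensates.
\<close>

lemma jacobi_sn_diff_2iK':
  assumes "0 < q" "q < 1"
  shows "jacobi_sn (u - 2 * iK' q) q = jacobi_sn u q"
proof -
  obtain C where C: "\<And>u. jacobi_sn u q = C * wave q u * Theta1 q u / Theta1 q (u - iK' q)"
    using jacobi_sn_eq_Theta1_quotient [OF assms] by blast
  have K: "ellK q \<noteq> 0"
    using ellK_pos [of q] assms by simp
  have "Theta1 q u = - Theta1 q (u - 2 * iK' q) / wave q (2 * u - 2 * iK' q)"
    using Theta1_add_2iK' [OF K, of "u - 2 * iK' q"] by (simp add: algebra_simps)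
  moreover have "Theta1 q (u - iK' q) =
      - Theta1 q (u - 2 * iK' q - iK' q) / wave q (2 * u - 2 * iK' q - 2 * iK' q)"
    using Theta1_add_2iK' [OF K, of "u - 2 * iK' q - iK' q"] by (simp add: algebra_simps)
  moreover have "wave q (2 * u - 2 * iK' q) =
      wave q (2 * u - 2 * iK' q - 2 * iK' q) * wave q (2 * iK' q)"
    unfolding wave_add [symmetric] by simp
  moreover have "wave q u = wave q (u - 2 * iK' q) * wave q (2 * iK' q)"
    unfolding wave_add [symmetric] by simp
  ultimately show ?thesis
    unfolding C by (simp only:) simp
qed


section \<open>Legs of the Laplace equation as sn quotients\<close>

definition shift_quotient :: "real \<Rightarrow> complex \<Rightarrow> complex" where
  "shift_quotient q z = Theta1 q ((z + iK' q) / 2) / Theta1 q ((z - iK' q) / 2)"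

lemma F_iK':
  "F q X Y (iK' q) = shift_quotient q (X + Y) * shift_quotient q (X - Y)"
  by (simp add: F_def shift_quotient_def)

lemma F_uminus: "F q X Y (- a) = 1 / F q X Y a"
  by (simp add: F_def)

text \<open>
  A shift of \<open>z\<close> by \<open>2 iK'\<close> moves the denominator of the quotient onto its old numerator, and
  the numerator to two half-periods from the old denominator. Hence the reciprocal on the right.
\<close>

lemma shift_quotient_add_2iK':
  assumes "ellK q \<noteq> 0"
  shows "shift_quotient q (z + 2 * iK' q) = - 1 / (wave q (z + iK' q) * shift_quotient q z)"
proof -
  have "Theta1 q ((z + 2 * iK' q + iK' q) / 2) = - Theta1 q ((z - iK' q) / 2) / wave q (z + iK' q)"
  proof -
    have "(z + 2 * iK' q + iK' q) / 2 = (z - iK' q) / 2 + 2 * iK' q"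
      and "2 * ((z - iK' q) / 2) + 2 * iK' q = z + iK' q"
      by (simp_all add: field_simps)
    then show ?thesis
      by (metis Theta1_add_2iK' [OF assms])
  qed
  moreover have "z + 2 * iK' q - iK' q = z + iK' q"
    by simp
  ultimately show ?thesis
    unfolding shift_quotient_def by (simp only:) simp
qed

lemma shift_quotient_add_sign:
  assumes "ellK q \<noteq> 0" "s = 1 \<or> s = - 1"
  shows "shift_quotient q (z + s * (2 * iK' q)) = - 1 / (wave q (z + s * iK' q) * shift_quotient q z)"
  using assms(2)
proof
  assume "s = - 1"
  then show ?thesis
    using shift_quotient_add_2iK' [OF assms(1), of "z - 2 * iK' q"]
    by (simp add: algebra_simps)
qed (simp add: shift_quotient_add_2iK' [OF assms(1)])

definition spherical_ring_factor :: "real \<Rightarrow> complex \<Rightarrow> complex \<Rightarrow> complex" where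
  "spherical_ring_factor q x y = jacobi_sn ((x - y + iK' q) / 2) q / jacobi_sn ((x + y + iK' q) / 2) q"

lemma spherical_ring_factor_eq:
  assumes "0 < q" "q < 1"
  shows "spherical_ring_factor q x y = shift_quotient q (x - y) / (wave q y * shift_quotient q (x + y))"
proof -
  obtain C where C: "C \<noteq> 0"
      "\<And>u. jacobi_sn u q = C * wave q u * Theta1 q u / Theta1 q (u - iK' q)"
    using jacobi_sn_eq_Theta1_quotient [OF assms] by blast
  have sn: "jacobi_sn ((z + iK' q) / 2) q = C * wave q ((z + iK' q) / 2) * shift_quotient q z" for z
  proof -
    have "(z + iK' q) / 2 - iK' q = (z - iK' q) / 2"
      by (simp add: field_simps)
    then show ?thesis
      unfolding C(2) [of "(z + iK' q) / 2"] shift_quotient_def by (simp only:) simp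
  qed
  have "wave q ((x + y + iK' q) / 2) = wave q ((x - y + iK' q) / 2) * wave q y"
    unfolding wave_add [symmetric] by (rule arg_cong [where f = "wave q"]) (simp add: field_simps)
  then show ?thesis
    using C(1) by (simp add: spherical_ring_factor_def sn)
qed

text \<open>
  A leg between consecutive lines: the signs at its ends are opposite, they cancel in \<open>X + Y\<close>, and
  \<open>X - Y\<close> is shifted by two half-periods. The exponential from the shift contains \<open>wave q y\<close>, the
  dependence on the neighbour that the sn quotient carries too, so only the value at the central
  vertex remains.
\<close>

lemma F_across_lines:
  assumes "0 < q" "q < 1" "s = 1 \<or> s = - 1"
  shows "F q (x + s * iK' q) (y - s * iK' q) (iK' q) =
    - 1 / (wave q (x + s * iK' q) * spherical_ring_factor q x y)"
proof -
  have K: "ellK q \<noteq> 0"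
    using ellK_pos [of q] assms by simp
  have wave: "wave q (x - y + s * iK' q) = wave q (x + s * iK' q) / wave q y"
    unfolding wave_diff [symmetric] by (simp add: algebra_simps)
  have "F q (x + s * iK' q) (y - s * iK' q) (iK' q) =
      shift_quotient q (x + y) * shift_quotient q (x - y + s * (2 * iK' q))"
    unfolding F_iK' by (simp add: algebra_simps)
  also have "\<dots> = - 1 / (wave q (x + s * iK' q) * spherical_ring_factor q x y)"
    by (simp add: wave shift_quotient_add_sign [OF K assms(3)] spherical_ring_factor_eq [OF assms(1,2)])
  finally show ?thesis .
qed

text \<open>
  A leg within one line: the signs are equal, and now \<open>X + Y\<close> is shifted. Through
  the opposite parameter the multiplier appears as the reciprocal of the one for a leg between
  lines, so that the two cancel.
\<close>

lemma F_along_line: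
  assumes "0 < q" "q < 1" "s = 1 \<or> s = - 1"
  shows "F q (x + s * iK' q) (y + s * iK' q) (- iK' q) =
    - wave q (x + s * iK' q) / spherical_ring_factor q x y"
proof -
  have K: "ellK q \<noteq> 0"
    using ellK_pos [of q] assms by simp
  have wave: "wave q (x + y + s * iK' q) = wave q (x + s * iK' q) * wave q y"
    unfolding wave_add [symmetric] by (simp add: algebra_simps)
  have "F q (x + s * iK' q) (y + s * iK' q) (- iK' q) =
      1 / (shift_quotient q (x + y + s * (2 * iK' q)) * shift_quotient q (x - y))"
    unfolding F_uminus F_iK' by (simp add: algebra_simps)
  also have "\<dots> = - wave q (x + s * iK' q) / spherical_ring_factor q x y"
    by (simp add: wave shift_quotient_add_sign [OF K assms(3)] spherical_ring_factor_eq [OF assms(1,2)])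
  finally show ?thesis .
qed


section \<open>The ring pattern equations\<close>

lemma nb_in_grid:
  assumes "v \<in> grid"
  shows "nb1 v \<in> grid" "nb2 v \<in> grid" "nb3 v \<in> grid" "nb4 v \<in> grid"
  using assms by (cases v; auto simp: grid_def)+

lemma prod_neighbours:
  "(\<Prod>w\<in>neighbours v. f w) = f (nb1 v) * f (nb2 v) * f (nb3 v) * f (nb4 v)"
  by (cases v) (simp add: neighbours_def mult.assoc)

lemma alternating_signs_nb:
  assumes "alternating_signs \<epsilon>" "v \<in> grid"
  shows "\<epsilon> (nb1 v) = - \<epsilon> v" "\<epsilon> (nb2 v) = \<epsilon> v" "\<epsilon> (nb3 v) = - \<epsilon> v" "\<epsilon> (nb4 v) = \<epsilon> v"
proof -
  have along: "\<epsilon> w = \<epsilon> u" if "fst w + snd w = fst u + snd u" "u \<in> grid" "w \<in> grid" for u w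
    using assms(1) that unfolding alternating_signs_def by blast
  have across: "\<epsilon> w = - \<epsilon> u" if "fst w + snd w = fst u + snd u + 2" "u \<in> grid" "w \<in> grid" for u w
    using assms(1) that unfolding alternating_signs_def by blast
  note nb = nb_in_grid [OF assms(2)]
  show "\<epsilon> (nb1 v) = - \<epsilon> v"
    by (rule across [OF _ assms(2) nb(1)]) (cases v, simp)
  show "\<epsilon> (nb2 v) = \<epsilon> v"
    by (rule along [OF _ assms(2) nb(2)]) (cases v, simp)
  show "\<epsilon> (nb4 v) = \<epsilon> v"
    by (rule along [OF _ assms(2) nb(4)]) (cases v, simp)
  have "\<epsilon> v = - \<epsilon> (nb3 v)"
    by (rule across [OF _ nb(3) assms(2)]) (cases v, simp)
  then show "\<epsilon> (nb3 v) = - \<epsilon> v" by simp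
qed

lemma spherical_ring_eq_iff_laplace_Q4:
  assumes q: "0 < q" "q < 1" and ab: "a - b = iK' q"
    and eps: "alternating_signs \<epsilon>"
    and X: "\<forall>v\<in>grid. X v = \<beta> v + of_int (\<epsilon> v) * iK' q"
    and v: "v \<in> grid"
  shows "spherical_ring_eq q \<beta> v \<longleftrightarrow> laplace_Q4 q a b X v"
proof -
  define s :: complex where "s = of_int (\<epsilon> v)"
  have s: "s = 1 \<or> s = - 1"
  proof -
    have "\<epsilon> v = 1 \<or> \<epsilon> v = - 1"
      using eps v unfolding alternating_signs_def by blast
    then show ?thesis
      by (auto simp: s_def)
  qed
  have ba: "b - a = - iK' q"
    using ab by (metis minus_diff_eq)
  define R where "R = (\<Prod>w\<in>neighbours v. spherical_ring_factor q (\<beta> v) (\<beta> w))"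
  have legs:
    "F q (X v) (X (nb1 v)) (a - b) = - 1 / (wave q (X v) * spherical_ring_factor q (\<beta> v) (\<beta> (nb1 v)))"
    "F q (X v) (X (nb2 v)) (b - a) = - wave q (X v) / spherical_ring_factor q (\<beta> v) (\<beta> (nb2 v))"
    "F q (X v) (X (nb3 v)) (a - b) = - 1 / (wave q (X v) * spherical_ring_factor q (\<beta> v) (\<beta> (nb3 v)))"
    "F q (X v) (X (nb4 v)) (b - a) = - wave q (X v) / spherical_ring_factor q (\<beta> v) (\<beta> (nb4 v))"
    using X v nb_in_grid [OF v]
    by (simp_all add: alternating_signs_nb [OF eps v] ab ba s_def [symmetric]
        F_across_lines [OF q s] F_along_line [OF q s])
  have "laplace_Q4 q a b X v \<longleftrightarrow> 1 / R = 1"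
    unfolding laplace_Q4_def legs R_def prod_neighbours by (simp add: ac_simps)
  \<comment> \<open>This includes the degenerate case: a vanishing theta function makes both products \<open>0\<close>.\<close>
  also have "\<dots> \<longleftrightarrow> R = 1"
    by (cases "R = 0") auto
  also have "\<dots> \<longleftrightarrow> spherical_ring_eq q \<beta> v"
    by (simp add: R_def spherical_ring_eq_def spherical_ring_factor_def)
  finally show ?thesis by simp
qed

text \<open>
  Differences of fields are unaffected by \<open>\<beta> = \<gamma> + iK'\<close>, while the arguments
  in the denominators change by the period \<open>2 iK'\<close> of sn.
\<close>

lemma hyperbolic_ring_eq_iff_spherical:
  assumes q: "0 < q" "q < 1"
    and \<beta>: "\<forall>v\<in>grid. \<beta> v = \<gamma> v + iK' q"
    and v: "v \<in> grid"
  shows "hyperbolic_ring_eq q \<gamma> v \<longleftrightarrow> spherical_ring_eq q \<beta> v"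
proof -
  have "jacobi_sn ((\<gamma> v - \<gamma> w + iK' q) / 2) q / jacobi_sn ((\<gamma> v + \<gamma> w - iK' q) / 2) q =
      jacobi_sn ((\<beta> v - \<beta> w + iK' q) / 2) q / jacobi_sn ((\<beta> v + \<beta> w + iK' q) / 2) q"
    if "w \<in> neighbours v" for w
  proof -
    have "w \<in> grid"
      using that nb_in_grid [OF v] by (auto simp: neighbours_def)
    then have \<gamma>: "\<gamma> w = \<beta> w - iK' q" "\<gamma> v = \<beta> v - iK' q"
      using \<beta> v by auto
    have "(\<gamma> v + \<gamma> w - iK' q) / 2 = (\<beta> v + \<beta> w + iK' q) / 2 - 2 * iK' q"
      by (simp add: \<gamma> field_simps)
    then have "jacobi_sn ((\<gamma> v + \<gamma> w - iK' q) / 2) q = jacobi_sn ((\<beta> v + \<beta> w + iK' q) / 2) q"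
      by (simp only: jacobi_sn_diff_2iK' [OF q])
    moreover have "\<gamma> v - \<gamma> w = \<beta> v - \<beta> w"
      by (simp add: \<gamma>)
    ultimately show ?thesis
      by simp
  qed
  then show ?thesis
    by (simp add: hyperbolic_ring_eq_def spherical_ring_eq_def)
qed

theorem theorem8p1:
  fixes q :: real and a b :: complex and \<epsilon> :: "vertex \<Rightarrow> int"
  assumes "0 < q" and "q < 1"
    and "a - b = iK' q"
    and "alternating_signs \<epsilon>"
  shows "(\<forall>\<beta> X :: vertex \<Rightarrow> complex.
            (\<forall>v\<in>grid. X v = \<beta> v + of_int (\<epsilon> v) * iK' q) \<longrightarrow>
            (\<forall>v\<in>grid. spherical_ring_eq q \<beta> v \<longleftrightarrow> laplace_Q4 q a b X v)) \<and>
         (\<forall>\<gamma> \<beta> X :: vertex \<Rightarrow> complex.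
            (\<forall>v\<in>grid. \<beta> v = \<gamma> v + iK' q) \<longrightarrow>
            (\<forall>v\<in>grid. X v = \<beta> v + of_int (\<epsilon> v) * iK' q) \<longrightarrow>
            (\<forall>v\<in>grid. hyperbolic_ring_eq q \<gamma> v \<longleftrightarrow> laplace_Q4 q a b X v))"
  using spherical_ring_eq_iff_laplace_Q4 [OF assms]
    hyperbolic_ring_eq_iff_spherical [OF assms(1,2)]
  by blast

end
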